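(* Let $L\in\mathrm{Lin}\,\mathbb H$ be symmetric with $\mathrm{Im}\,L$ positive semidefinite, and let $P:\mathbb H_{\rm eff}^*\to\mathbb H^*$ be an embedding map with pseudo inverse $P^I$ and $Q=1-PP^I$. Let $L_{\rm ref}\in\mathrm{Lin}\,\mathbb H$ be a symmetric operator with $L_{\rm ref}Q=QL_{\rm ref}$, let $V:=L_{\rm ref}-L$, suppose that $G_{\rm ref}$ is a $Q$-resolvent of $L_{\rm ref}$, and suppose that, with $W:=G_{\rm ref}V$, the inverse $\Omega:=(1-W)^{-1}$ exists. Then $G:=\Omega G_{\rm ref}$ is a $Q$-resolvent of $L=L_{\rm ref}-V$, and with $T:=V+VGV$ and $L_{\rm eff}:=P^TLP-P^TLGLP$ the following relations hold: $$\Omega=1+GV,\qquad G_{\rm ref}=\Omega^{-1}G,$$ $$\Omega P=(1-GL)P,\qquad \Omega^TP=P,\qquad T=V\Omega=\Omega^TV,$$ $$P^TL\Omega P=L_{\rm eff}=P^T(L_{\rm ref}-T)P .$$ Moreover, $$\Omega=1+W\Omega=1+\Omega W,$$ $$T=V+TW=V+W^TT,$$ $$G=G_{\rm ref}+WG=G_{\rm ref}+GW^T .$$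
   Context: Spaces. $\mathrm{Lin}(V,W)$ is the space of continuous linear maps between topological vector spaces and $\mathrm{Lin}\,V=\mathrm{Lin}(V,V)$. $\mathbb H$ and $\mathbb H_{\rm eff}$ are complex topological vector spaces, each with a complex conjugation $\varphi\mapsto\bar\varphi$ and a continuous symmetric bilinear form $\varphi^T\psi$ that is compatible with conjugation and definite in the sense that $\varphi^*\psi:=\bar\varphi^T\psi$ is a positive definite Hermitian inner product. $\mathbb H^*$ is the continuous dual, with pairing $\varphi^T\psi=\psi^T\varphi$ for $\varphi\in\mathbb H$, $\psi\in\mathbb H^*$; the bilinear form embeds $\mathbb H$ into $\mathbb H^*$ (same for $\mathbb H_{\rm eff}$). Operators. The transpose $A^T$ is defined by $(A^T\varphi)^T\psi=\varphi^TA\psi$ for $\varphi,\psi\in\mathbb H$; $A\in\mathrm{Lin}\,\mathbb H$ is symmetric if $A^T=A$. An $A\in\mathrm{Lin}\,\mathbb H$ with $A^T\in\mathrm{Lin}\,\mathbb H$ is extended to $\mathbb H^*$ by $\varphi^TA\psi=(A^T\varphi)^T\psi$ for $\varphi\in\mathbb H,\psi\in\mathbb H^*$. Existence of $(1-W)^{-1}$ means invertibility of $1-W$ in $\mathrm{Lin}\,\mathbb H$ (with corresponding extensions to $\mathbb H^*$). $A^*=\bar A^T$ is the adjoint, $\mathrm{Im}\,A=\frac1{2i}(A-A^* )$, and $A$ is positive semidefinite if $\psi^*A\psi\ge0$ for all $\psi\in\mathbb H$. All products below are compositions of operators on the dual spaces. Embedding map. $P$ is an injective closed linear operator from $\mathbb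 H_{\rm eff}^*$ to $\mathbb H^*$ with $\bar P=P$ (it commutes with conjugation) and $P\psi_{\rm eff}\in\mathbb H$ for $\psi_{\rm eff}\in\mathbb H_{\rm eff}$. Its transpose $P^T=P^*$ maps $\mathbb H^*$ to $\mathbb H_{\rm eff}^*$ and $\mathbb H$ to $\mathbb H_{\rm eff}$, with $(P^T\psi)^T\eta=\psi^TP\eta$ for $\psi\in\mathbb H^*,\eta\in\mathbb H_{\rm eff}$ and $(P^T\varphi)^T\chi=\varphi^TP\chi$ for $\varphi\in\mathbb H,\chi\in\mathbb H_{\rm eff}^*$. $P^TP$ is invertible on $\mathbb H_{\rm eff}^*$ and on $\mathbb H_{\rm eff}$. The pseudo inverse is $P^I:=(P^TP)^{-1}P^T$, and $Q:=1-PP^I$, so that $P^IP=1$, $P^TQ=P^IQ=0$, $QP=0$, $Q^2=Q^T=Q$. $Q$-resolvent. A $Q$-resolvent of a symmetric $A\in\mathrm{Lin}\,\mathbb H$ is a symmetric $G\in\mathrm{Lin}\,\mathbb H$ with $GP=0$ and $GAQ=Q$. *)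

theory Defs
  imports "HOL-Analysis.Analysis" "HOL-Library.Function_Algebras"
begin

section \<open>Complex topological vector spaces and their duals\<close>

class scaleC =
  fixes scaleC :: "complex \<Rightarrow> 'a \<Rightarrow> 'a" (infixr \<open>*\<^sub>C\<close> 75)

class complex_vector = scaleC + ab_group_add +
  assumes scaleC_add_right: "a *\<^sub>C (x + y) = a *\<^sub>C x + a *\<^sub>C y"
    and scaleC_add_left: "(a + b) *\<^sub>C x = a *\<^sub>C x + b *\<^sub>C x"
    and scaleC_scaleC: "a *\<^sub>C b *\<^sub>C x = (a * b) *\<^sub>C x"
    and scaleC_one: "1 *\<^sub>C x = x"

lemma vector_space_scaleC: "vector_space (scaleC :: complex \<Rightarrow> 'a \<Rightarrow> 'a::complex_vector)"
  by unfold_locales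
    (simp_all add: scaleC_add_right scaleC_add_left scaleC_scaleC scaleC_one)

text \<open>Continuity conditions in the class specifications are stated through neighbourhood filters; the
  lemmas following the classes give the usual form.\<close>

class complex_tvs = complex_vector + topological_ab_group_add +
  assumes tendsto_scaleC_Pair: "LIM p (nhds a \<times>\<^sub>F nhds x). fst p *\<^sub>C snd p :> nhds (a *\<^sub>C x)"

lemma continuous_scaleC:
  "continuous_on UNIV (\<lambda>p :: complex \<times> 'a::complex_tvs. fst p *\<^sub>C snd p)"
  unfolding continuous_on_def
proof (rule ballI)
  fix p :: "complex \<times> 'a"
  show "((\<lambda>p. fst p *\<^sub>C snd p) \<longlongrightarrow> fst p *\<^sub>C snd p) (at p)"
    using tendsto_scaleC_Pair[of "fst p" "snd p"]
      tendsto_at_iff_tendsto_nhds[of "\<lambda>p. fst p *\<^sub>C snd p" p]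
    by (simp flip: nhds_prod)
qed

definition clinear :: "('a::complex_vector \<Rightarrow> 'b::complex_vector) \<Rightarrow> bool"
  where "clinear f \<longleftrightarrow> Vector_Spaces.linear scaleC scaleC f"

definition Lin :: "('a::complex_tvs \<Rightarrow> 'b::complex_tvs) set"
  where "Lin = {f. clinear f \<and> continuous_on UNIV f}"

definition clinear_form :: "('a::complex_vector \<Rightarrow> complex) \<Rightarrow> bool"
  where "clinear_form f \<longleftrightarrow> Vector_Spaces.linear scaleC (*) f"

lemma clinear_form_iff:
  "clinear_form f \<longleftrightarrow> (\<forall>x y. f (x + y) = f x + f y) \<and> (\<forall>c x. f (c *\<^sub>C x) = c * f x)"
proof -
  have "vector_space ((*) :: complex \<Rightarrow> complex \<Rightarrow> complex)"
    by unfold_locales (simp_all add: algebra_simps)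
  then show ?thesis
    unfolding clinear_form_def Vector_Spaces.linear_iff using vector_space_scaleC by auto
qed

text \<open>The value \<open>pair \<psi> \<phi>\<close> is the pairing \<open>\<psi>\<^sup>T\<phi> = \<phi>\<^sup>T\<psi>\<close> of a dual vector \<open>\<psi>\<close> with a vector \<open>\<phi>\<close>.\<close>

typedef (overloaded) 'a dual =
  "{f :: 'a::complex_tvs \<Rightarrow> complex. clinear_form f \<and> continuous_on UNIV f}"
  morphisms pair Dual
  by (rule exI[of _ "\<lambda>_. 0"]) (simp add: clinear_form_iff)

setup_lifting type_definition_dual

instantiation dual :: (complex_tvs) complex_vector
begin

lift_definition zero_dual :: "'a dual" is "\<lambda>_. 0"
  by (simp add: clinear_form_iff)

lift_definition plus_dual :: "'a dual \<Rightarrow> 'a dual \<Rightarrow> 'a dual" is "\<lambda>f g x. f x + g x"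
  by (auto simp: clinear_form_iff algebra_simps intro!: continuous_intros)

lift_definition minus_dual :: "'a dual \<Rightarrow> 'a dual \<Rightarrow> 'a dual" is "\<lambda>f g x. f x - g x"
  by (auto simp: clinear_form_iff algebra_simps intro!: continuous_intros)

lift_definition uminus_dual :: "'a dual \<Rightarrow> 'a dual" is "\<lambda>f x. - f x"
  by (auto simp: clinear_form_iff algebra_simps intro!: continuous_intros)

lift_definition scaleC_dual :: "complex \<Rightarrow> 'a dual \<Rightarrow> 'a dual" is "\<lambda>c f x. c * f x"
  by (auto simp: clinear_form_iff algebra_simps intro!: continuous_intros)

instance
  by standard (transfer, force simp: algebra_simps)+

end

text \<open>The dual carries the weak-* topology, i.e. the one induced by the product topology on functions.
  It is used only to say that the graph of an operator between duals is closed.\<close>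

instantiation dual :: (complex_tvs) topological_space
begin

definition open_dual :: "'a dual set \<Rightarrow> bool"
  where "open_dual U \<longleftrightarrow> (\<exists>V. open V \<and> U = pair -` V)"

instance
proof
  show "open (UNIV :: 'a dual set)"
    unfolding open_dual_def by (metis open_UNIV vimage_UNIV)
next
  fix S T :: "'a dual set"
  assume "open S" "open T"
  then show "open (S \<inter> T)"
    unfolding open_dual_def by (metis open_Int vimage_Int)
next
  fix K :: "'a dual set set"
  assume "\<forall>S\<in>K. open S"
  then obtain V where V: "\<forall>S\<in>K. open (V S) \<and> S = pair -` V S"
    unfolding open_dual_def by metis
  have "\<Union>K = pair -` (\<Union>S\<in>K. V S)"
    using V by auto
  moreover have "open (\<Union>S\<in>K. V S)"
    using V by auto
  ultimately show "open (\<Union>K)"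
    unfolding open_dual_def by blast
qed

end


section \<open>Spaces with conjugation and bilinear form\<close>

text \<open>The map \<open>cbar\<close> is the complex conjugation and \<open>bform \<phi> \<psi>\<close> the bilinear form \<open>\<phi>\<^sup>T\<psi>\<close>.
  Continuity of the conjugation makes the conjugate of a continuous functional continuous.\<close>

class conj_form_space = complex_tvs +
  fixes cbar :: "'a \<Rightarrow> 'a"
    and bform :: "'a \<Rightarrow> 'a \<Rightarrow> complex"
  assumes cbar_add: "cbar (x + y) = cbar x + cbar y"
    and cbar_scaleC: "cbar (c *\<^sub>C x) = cnj c *\<^sub>C cbar x"
    and cbar_cbar: "cbar (cbar x) = x"
    and tendsto_cbar: "LIM y nhds x. cbar y :> nhds (cbar x)"
    and bform_commute: "bform x y = bform y x"
    and bform_add_right: "bform x (y + z) = bform x y + bform x z"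
    and bform_scaleC_right: "bform x (c *\<^sub>C y) = c * bform x y"
    and tendsto_bform_Pair: "LIM p (nhds x \<times>\<^sub>F nhds y). bform (fst p) (snd p) :> nhds (bform x y)"
    and bform_cbar: "bform (cbar x) (cbar y) = cnj (bform x y)"
    and bform_definite: "x \<noteq> 0 \<Longrightarrow> bform (cbar x) x \<in> \<real> \<and> 0 < Re (bform (cbar x) x)"

lemma continuous_cbar: "continuous_on UNIV (cbar :: 'a::conj_form_space \<Rightarrow> 'a)"
  unfolding continuous_on_def
proof (rule ballI)
  fix x :: 'a
  show "(cbar \<longlongrightarrow> cbar x) (at x)"
    using tendsto_cbar[of x] by (simp add: tendsto_at_iff_tendsto_nhds)
qed

lemma continuous_bform:
  "continuous_on UNIV (\<lambda>p :: 'a::conj_form_space \<times> 'a. bform (fst p) (snd p))"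
  unfolding continuous_on_def
proof (rule ballI)
  fix p :: "'a \<times> 'a"
  show "((\<lambda>p. bform (fst p) (snd p)) \<longlongrightarrow> bform (fst p) (snd p)) (at p)"
    using tendsto_bform_Pair[of "fst p" "snd p"]
      tendsto_at_iff_tendsto_nhds[of "\<lambda>p. bform (fst p) (snd p)" p]
    by (simp flip: nhds_prod)
qed

lemma continuous_bform_right: "continuous_on UNIV (bform (x :: 'a::conj_form_space))"
proof -
  have "continuous_on UNIV (\<lambda>y. (\<lambda>p. bform (fst p) (snd p)) (x, y))"
    by (rule continuous_on_compose2[OF continuous_bform]) (auto intro!: continuous_intros)
  then show ?thesis by simp
qed

text \<open>The embedding of the space into its dual.\<close>

lift_definition emb :: "'a::conj_form_space \<Rightarrow> 'a dual" is "\<lambda>\<phi> \<psi>. bform \<phi> \<psi>"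
  by (simp add: clinear_form_iff bform_add_right bform_scaleC_right continuous_bform_right)

text \<open>The conjugation on the dual, which extends \<open>cbar\<close>.\<close>

lift_definition dual_cbar :: "'a::conj_form_space dual \<Rightarrow> 'a dual" is "\<lambda>f \<phi>. cnj (f (cbar \<phi>))"
  by (auto simp: clinear_form_iff cbar_add cbar_scaleC
      intro!: continuous_intros continuous_on_compose2[OF _ continuous_cbar])

lemma bform_right_eqI:
  assumes "\<And>z. bform z x = bform z (y :: 'a::conj_form_space)"
  shows "x = y"
proof (rule ccontr)
  assume "x \<noteq> y"
  have "bform z (x - y) + bform z y = bform z x" for z
    by (simp flip: bform_add_right)
  then have "bform z (x - y) = 0" for z
    using assms[of z] by (metis add_cancel_left_left)
  with bform_definite[of "x - y"] \<open>x \<noteq> y\<close> show False by auto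
qed

lemma inj_emb: "inj emb"
proof (rule injI)
  fix x y :: 'a
  assume "emb x = emb y"
  then have "pair (emb x) z = pair (emb y) z" for z by simp
  then show "x = y"
    by (intro bform_right_eqI) (simp add: emb.rep_eq bform_commute[of _ x] bform_commute[of _ y])
qed

lemma dual_cbar_emb: "dual_cbar (emb \<phi>) = emb (cbar \<phi>)"
  by transfer (simp add: fun_eq_iff cbar_cbar flip: bform_cbar)


section \<open>Operators\<close>

definition is_transpose :: "('a::conj_form_space \<Rightarrow> 'a) \<Rightarrow> ('a \<Rightarrow> 'a) \<Rightarrow> bool"
  where "is_transpose A B \<longleftrightarrow> (\<forall>\<phi> \<psi>. bform (B \<phi>) \<psi> = bform \<phi> (A \<psi>))"

definition transpose_op :: "('a::conj_form_space \<Rightarrow> 'a) \<Rightarrow> 'a \<Rightarrow> 'a"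
  where "transpose_op A = (THE B. is_transpose A B)"

lemma transpose_op_eqI: "is_transpose A B \<Longrightarrow> transpose_op A = B"
  unfolding transpose_op_def is_transpose_def
proof (rule the_equality)
  fix B'
  assume "\<forall>\<phi> \<psi>. bform (B' \<phi>) \<psi> = bform \<phi> (A \<psi>)"
  moreover assume "\<forall>\<phi> \<psi>. bform (B \<phi>) \<psi> = bform \<phi> (A \<psi>)"
  ultimately have "bform z (B' \<phi>) = bform z (B \<phi>)" for z \<phi>
    by (simp add: bform_commute[of z])
  then show "B' = B"
    by (intro ext bform_right_eqI)
qed

definition symmetric_op :: "('a::conj_form_space \<Rightarrow> 'a) \<Rightarrow> bool"
  where "symmetric_op A \<longleftrightarrow> A \<in> Lin \<and> is_transpose A A"

text \<open>The extension of \<open>A\<close> to the dual, \<open>\<phi>\<^sup>TA\<psi> = (A\<^sup>T\<phi>)\<^sup>T\<psi>\<close>. It is meaningful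
  when \<open>A\<close> and its transpose are in \<^term>\<open>Lin\<close>.\<close>

definition extd :: "('a::conj_form_space \<Rightarrow> 'a) \<Rightarrow> 'a dual \<Rightarrow> 'a dual"
  where "extd A \<psi> = Dual (\<lambda>\<phi>. pair \<psi> (transpose_op A \<phi>))"

lemma pair_extd:
  assumes "is_transpose A B" "B \<in> Lin"
  shows "pair (extd A \<psi>) \<phi> = pair \<psi> (B \<phi>)"
proof -
  have B: "B (x + y) = B x + B y" "B (c *\<^sub>C x) = c *\<^sub>C B x" "continuous_on UNIV B" for x y c
    using assms(2) by (auto simp: Lin_def clinear_def Vector_Spaces.linear_iff)
  have \<psi>: "clinear_form (pair \<psi>)" "continuous_on UNIV (pair \<psi>)"
    using pair[of \<psi>] by auto
  have "(\<lambda>\<phi>. pair \<psi> (B \<phi>)) \<in> {f. clinear_form f \<and> continuous_on UNIV f}"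
    using \<psi>(1) by (auto simp: clinear_form_iff B intro: continuous_on_compose2[OF \<psi>(2) B(3)])
  then show ?thesis
    by (simp add: extd_def transpose_op_eqI[OF assms(1)] Dual_inverse)
qed

lemma extd_emb:
  assumes "is_transpose A B" "B \<in> Lin"
  shows "extd A (emb \<phi>) = emb (A \<phi>)"
proof -
  have "pair (extd A (emb \<phi>)) \<xi> = pair (emb (A \<phi>)) \<xi>" for \<xi>
    using assms(1) by (simp add: pair_extd[OF assms] emb.rep_eq is_transpose_def bform_commute)
  then show ?thesis
    by (metis ext pair_inject)
qed

definition conj_op :: "('a::conj_form_space \<Rightarrow> 'a) \<Rightarrow> 'a \<Rightarrow> 'a"
  where "conj_op A \<phi> = cbar (A (cbar \<phi>))"

definition adjoint_op :: "('a::conj_form_space \<Rightarrow> 'a) \<Rightarrow> 'a \<Rightarrow> 'a"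
  where "adjoint_op A = transpose_op (conj_op A)"

definition Im_op :: "('a::conj_form_space \<Rightarrow> 'a) \<Rightarrow> 'a \<Rightarrow> 'a"
  where "Im_op A \<phi> = (1 / (2 * \<i>)) *\<^sub>C (A \<phi> - adjoint_op A \<phi>)"

definition pos_semidef :: "('a::conj_form_space \<Rightarrow> 'a) \<Rightarrow> bool"
  where "pos_semidef A \<longleftrightarrow> (\<forall>\<psi>. bform (cbar \<psi>) (A \<psi>) \<in> \<real> \<and> 0 \<le> Re (bform (cbar \<psi>) (A \<psi>)))"

definition invertible_Lin :: "('a::conj_form_space \<Rightarrow> 'a) \<Rightarrow> bool"
  where "invertible_Lin A \<longleftrightarrow> A \<in> Lin \<and> bij A \<and> inv A \<in> Lin"


section \<open>Embedding maps and resolvents\<close>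

text \<open>The transpose of \<open>P\<close> has to satisfy two identities: \<open>(P\<^sup>T\<psi>)\<^sup>T\<eta> = \<psi>\<^sup>TP\<eta>\<close> for \<open>\<psi>\<close> in the
  dual, where \<open>P\<eta>\<close> is the vector \<open>\<phi>\<close> below, and \<open>(P\<^sup>T\<phi>)\<^sup>T\<xi> = \<phi>\<^sup>TP\<xi>\<close> for \<open>\<xi>\<close> in the dual,
  where \<open>P\<^sup>T\<phi>\<close> is the vector \<open>\<eta>\<close> below.\<close>

definition is_emb_transpose ::
    "('e::conj_form_space dual \<Rightarrow> 'h::conj_form_space dual) \<Rightarrow> ('h dual \<Rightarrow> 'e dual) \<Rightarrow> bool"
  where "is_emb_transpose P R \<longleftrightarrow>
    (\<forall>\<eta>. \<exists>\<phi>. P (emb \<eta>) = emb \<phi> \<and> (\<forall>\<psi>. pair (R \<psi>) \<eta> = pair \<psi> \<phi>)) \<and>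
    (\<forall>\<phi>. \<exists>\<eta>. R (emb \<phi>) = emb \<eta> \<and> (\<forall>\<xi>. pair \<xi> \<eta> = pair (P \<xi>) \<phi>))"

definition emb_transp ::
    "('e::conj_form_space dual \<Rightarrow> 'h::conj_form_space dual) \<Rightarrow> 'h dual \<Rightarrow> 'e dual"
  where "emb_transp P = (THE R. is_emb_transpose P R)"

lemma emb_transp_eqI:
  assumes "is_emb_transpose P R"
  shows "emb_transp P = R"
  unfolding emb_transp_def
proof (rule the_equality)
  fix R'
  assume R': "is_emb_transpose P R'"
  have "pair (R' \<psi>) \<eta> = pair (R \<psi>) \<eta>" for \<psi> \<eta>
    using R' assms unfolding is_emb_transpose_def by (metis injD inj_emb)
  then show "R' = R"
    by (metis ext pair_inject)
qed (fact assms)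

definition is_embedding_map ::
    "('e::conj_form_space dual \<Rightarrow> 'h::conj_form_space dual) \<Rightarrow> bool"
  where "is_embedding_map P \<longleftrightarrow>
    clinear P \<and> inj P \<and> closed (range (\<lambda>\<xi>. (\<xi>, P \<xi>))) \<and>
    (\<forall>\<xi>. P (dual_cbar \<xi>) = dual_cbar (P \<xi>)) \<and>
    P ` range emb \<subseteq> range emb \<and>
    (\<exists>R. is_emb_transpose P R) \<and>
    bij (emb_transp P \<circ> P) \<and>
    bij_betw (emb_transp P \<circ> P) (range emb) (range emb)"

definition pseudo_inv ::
    "('e::conj_form_space dual \<Rightarrow> 'h::conj_form_space dual) \<Rightarrow> 'h dual \<Rightarrow> 'e dual"
  where "pseudo_inv P = inv (emb_transp P \<circ> P) \<circ> emb_transp P"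

definition Qproj ::
    "('e::conj_form_space dual \<Rightarrow> 'h::conj_form_space dual) \<Rightarrow> 'h dual \<Rightarrow> 'h dual"
  where "Qproj P = id - (P \<circ> pseudo_inv P)"

definition Q_resolvent ::
    "('e::conj_form_space dual \<Rightarrow> 'h::conj_form_space dual) \<Rightarrow> ('h \<Rightarrow> 'h) \<Rightarrow> ('h \<Rightarrow> 'h) \<Rightarrow> bool"
  where "Q_resolvent P A G \<longleftrightarrow>
    symmetric_op A \<and> symmetric_op G \<and>
    extd G \<circ> P = 0 \<and> extd G \<circ> extd A \<circ> Qproj P = Qproj P"

end

theory Submission
  imports Defs
begin

text \<open>
  Since \<open>G = \<Omega> G\<^sub>r\<^sub>e\<^sub>f\<close> and \<open>W = G\<^sub>r\<^sub>e\<^sub>f V\<close>, one has \<open>\<Omega>W = GV\<close>, so that \<open>\<Omega> = 1 + GV\<close>; the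
  transpose of \<open>1 - W\<close> has the inverse \<open>1 + VG\<close>, which makes \<open>G\<close> symmetric. The relations not
  involving \<open>P\<close> are identities on \<open>\<H>\<close> itself, where every operator has a continuous
  transpose, and extension to the dual is then an algebra homomorphism. The relations with \<open>P\<close>
  rest on \<open>GP = 0\<close> and \<open>G L\<^sub>r\<^sub>e\<^sub>f P = 0\<close>. The latter holds because \<open>Q L\<^sub>r\<^sub>e\<^sub>f P = L\<^sub>r\<^sub>e\<^sub>f QP = 0\<close> puts the
  range of \<open>L\<^sub>r\<^sub>e\<^sub>f P\<close> into that of \<open>P\<close>; its transpose is \<open>P\<^sup>T L\<^sub>r\<^sub>e\<^sub>f G = 0\<close>.
\<close>

section \<open>Elementary rules for pairings, the bilinear form and continuous linear maps\<close>

lemma dual_eqI: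
  assumes "\<And>\<phi>. pair \<psi> \<phi> = pair \<psi>' \<phi>"
  shows "\<psi> = \<psi>'"
  using assms by (metis ext pair_inject)

lemma pair_add_right: "pair \<psi> (x + y) = pair \<psi> x + pair \<psi> y"
  using pair[of \<psi>] by (auto simp: clinear_form_iff)

lemma pair_diff_right: "pair \<psi> (x - y) = pair \<psi> x - pair \<psi> y"
  using pair_add_right[of \<psi> "x - y" y] by simp

lemma bform_diff_right: "bform x (y - z) = bform x y - bform x z"
  using bform_add_right[of x "y - z" z] by simp

lemma bform_add_left: "bform (x + y) z = bform x z + bform y z"
  by (metis bform_add_right bform_commute)

lemma bform_diff_left: "bform (x - y) z = bform x z - bform y z"
  by (metis bform_diff_right bform_commute)

lemma scaleC_diff_right:
  fixes x y :: "'a::complex_vector"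
  shows "c *\<^sub>C (x - y) = c *\<^sub>C x - c *\<^sub>C y"
  using scaleC_add_right[of c "x - y" y] by simp

lemma clinear_iff:
  "clinear f \<longleftrightarrow> (\<forall>x y. f (x + y) = f x + f y) \<and> (\<forall>c x. f (c *\<^sub>C x) = c *\<^sub>C f x)"
  by (simp add: clinear_def Vector_Spaces.linear_iff vector_space_scaleC)

lemma clinear_add: "clinear f \<Longrightarrow> f (x + y) = f x + f y"
  by (simp add: clinear_iff)

lemma clinear_diff: "clinear f \<Longrightarrow> f (x - y) = f x - f y"
  using clinear_add[of f "x - y" y] by simp

lemma Lin_clinear: "A \<in> Lin \<Longrightarrow> clinear A"
  by (simp add: Lin_def)

lemmas Lin_apply_add = clinear_add[OF Lin_clinear]
  and Lin_apply_diff = clinear_diff[OF Lin_clinear]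

lemma Lin_id: "id \<in> Lin"
  by (simp add: Lin_def clinear_iff)

lemma Lin_add: "A \<in> Lin \<Longrightarrow> B \<in> Lin \<Longrightarrow> A + B \<in> Lin"
  by (auto simp: Lin_def clinear_iff scaleC_add_right plus_fun_def intro!: continuous_on_add)

lemma Lin_diff: "A \<in> Lin \<Longrightarrow> B \<in> Lin \<Longrightarrow> A - B \<in> Lin"
  by (auto simp: Lin_def clinear_iff scaleC_diff_right fun_diff_def intro!: continuous_on_diff)

lemma Lin_comp: "A \<in> Lin \<Longrightarrow> B \<in> Lin \<Longrightarrow> A \<circ> B \<in> Lin"
  by (auto simp: Lin_def clinear_iff comp_def intro: continuous_on_compose2)

section \<open>Operators with a continuous transpose\<close>

text \<open>The transpose is carried along as a second argument, because the \<open>THE\<close> in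
  \<open>transpose_op\<close> is meaningful only once a transpose is known to exist. Continuity of
  both members makes the relation symmetric and gives \<open>extd\<close> its intended meaning on
  either of them.\<close>

definition transpose_pair :: "('a::conj_form_space \<Rightarrow> 'a) \<Rightarrow> ('a \<Rightarrow> 'a) \<Rightarrow> bool"
  where "transpose_pair A B \<longleftrightarrow> A \<in> Lin \<and> B \<in> Lin \<and> is_transpose A B"

lemma symmetric_op_iff_transpose_pair: "symmetric_op A \<longleftrightarrow> transpose_pair A A"
  by (auto simp: symmetric_op_def transpose_pair_def)

lemma transpose_pair_sym: "transpose_pair A B \<Longrightarrow> transpose_pair B A"
  unfolding transpose_pair_def is_transpose_def by (metis bform_commute)

lemma transpose_pair_id: "transpose_pair id id"
  by (simp add: transpose_pair_def is_transpose_def Lin_id)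

lemma transpose_pair_add:
  "transpose_pair A A' \<Longrightarrow> transpose_pair B B' \<Longrightarrow> transpose_pair (A + B) (A' + B')"
  by (simp add: transpose_pair_def is_transpose_def Lin_add bform_add_left bform_add_right)

lemma transpose_pair_diff:
  "transpose_pair A A' \<Longrightarrow> transpose_pair B B' \<Longrightarrow> transpose_pair (A - B) (A' - B')"
  by (simp add: transpose_pair_def is_transpose_def Lin_diff bform_diff_left bform_diff_right)

lemma transpose_pair_comp:
  "transpose_pair A A' \<Longrightarrow> transpose_pair B B' \<Longrightarrow> transpose_pair (A \<circ> B) (B' \<circ> A')"
  by (simp add: transpose_pair_def is_transpose_def Lin_comp)

text \<open>Insert \<open>A (B \<psi>) = \<psi>\<close> on the right of the form, move
  \<open>A\<close> across as \<open>A'\<close>, and cancel \<open>A'\<close> against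
  \<open>B'\<close>. Right inverses on both sides are all that this uses.\<close>

lemma transpose_pair_inverse:
  assumes "transpose_pair A A'" and "B \<in> Lin" "B' \<in> Lin"
    and "A \<circ> B = id" "A' \<circ> B' = id"
  shows "transpose_pair B B'"
proof -
  have "bform (B' \<phi>) \<psi> = bform \<phi> (B \<psi>)" for \<phi> \<psi>
  proof -
    have "bform (B' \<phi>) (A (B \<psi>)) = bform (A' (B' \<phi>)) (B \<psi>)"
      using assms(1) by (simp add: transpose_pair_def is_transpose_def)
    then show ?thesis
      using assms(4,5) by (metis comp_apply id_apply)
  qed
  then show ?thesis
    using assms(2,3) by (simp add: transpose_pair_def is_transpose_def)
qed

lemma transpose_op_pair: "transpose_pair A B \<Longrightarrow> transpose_op A = B"
  by (simp add: transpose_pair_def transpose_op_eqI)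

lemma pair_extd_transpose: "transpose_pair A B \<Longrightarrow> pair (extd A \<psi>) \<phi> = pair \<psi> (B \<phi>)"
  by (simp add: transpose_pair_def pair_extd)

lemma extd_emb_transpose: "transpose_pair A B \<Longrightarrow> extd A (emb \<phi>) = emb (A \<phi>)"
  by (auto simp: transpose_pair_def intro: extd_emb)

lemma extd_id: "extd id = id"
  by (rule ext, rule dual_eqI) (simp add: pair_extd_transpose[OF transpose_pair_id])

lemma extd_add:
  assumes "transpose_pair A A'" "transpose_pair B B'"
  shows "extd (A + B) = extd A + extd B"
  by (rule ext, rule dual_eqI)
    (simp add: pair_extd_transpose[OF transpose_pair_add[OF assms]] plus_dual.rep_eq
      pair_extd_transpose[OF assms(1)] pair_extd_transpose[OF assms(2)] pair_add_right)

lemma extd_diff: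
  assumes "transpose_pair A A'" "transpose_pair B B'"
  shows "extd (A - B) = extd A - extd B"
  by (rule ext, rule dual_eqI)
    (simp add: pair_extd_transpose[OF transpose_pair_diff[OF assms]] minus_dual.rep_eq
      pair_extd_transpose[OF assms(1)] pair_extd_transpose[OF assms(2)] pair_diff_right)

lemma extd_comp:
  assumes "transpose_pair A A'" "transpose_pair B B'"
  shows "extd (A \<circ> B) = extd A \<circ> extd B"
  by (rule ext, rule dual_eqI)
    (simp add: pair_extd_transpose[OF transpose_pair_comp[OF assms]]
      pair_extd_transpose[OF assms(1)] pair_extd_transpose[OF assms(2)])

lemma extd_apply_add:
  "transpose_pair A B \<Longrightarrow> extd A (\<psi> + \<psi>') = extd A \<psi> + extd A \<psi>'"
  by (rule dual_eqI) (simp add: pair_extd_transpose plus_dual.rep_eq)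

lemma extd_apply_diff:
  "transpose_pair A B \<Longrightarrow> extd A (\<psi> - \<psi>') = extd A \<psi> - extd A \<psi>'"
  by (rule dual_eqI) (simp add: pair_extd_transpose minus_dual.rep_eq)

section \<open>Embedding maps\<close>

lemma is_emb_transpose_emb_transp:
  assumes "is_embedding_map P"
  shows "is_emb_transpose P (emb_transp P)"
proof -
  obtain R where R: "is_emb_transpose P R"
    using assms by (auto simp: is_embedding_map_def)
  show ?thesis
    using R by (simp add: emb_transp_eqI[OF R])
qed

text \<open>Linearity of the transpose is not part of its definition. It follows since, for fixed
  \<open>\<eta>\<close>, the value of \<open>emb_transp P \<psi>\<close> at \<open>\<eta>\<close> is
  the evaluation of \<open>\<psi>\<close> at one fixed vector representing
  \<open>P (emb \<eta>)\<close>.\<close>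

lemma emb_transp_apply_diff:
  assumes "is_embedding_map P"
  shows "emb_transp P (\<psi> - \<psi>') = emb_transp P \<psi> - emb_transp P \<psi>'"
proof (rule dual_eqI)
  fix \<eta>
  obtain \<phi> where "\<And>\<psi>. pair (emb_transp P \<psi>) \<eta> = pair \<psi> \<phi>"
    using is_emb_transpose_emb_transp[OF assms] unfolding is_emb_transpose_def by blast
  then show "pair (emb_transp P (\<psi> - \<psi>')) \<eta> = pair (emb_transp P \<psi> - emb_transp P \<psi>') \<eta>"
    by (simp add: minus_dual.rep_eq)
qed

lemma Qproj_comp_self:
  assumes "is_embedding_map P"
  shows "Qproj P (P \<xi>) = 0"
proof -
  have "inj (emb_transp P \<circ> P)"
    using assms by (simp add: is_embedding_map_def bij_def)
  then have "pseudo_inv P (P \<xi>) = \<xi>"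
    using inv_f_f[of "emb_transp P \<circ> P" \<xi>] by (simp add: pseudo_inv_def)
  then show ?thesis
    by (simp add: Qproj_def)
qed

text \<open>The kernel of \<open>Qproj P\<close> consists of the fixed points of
  \<open>P \<circ> pseudo_inv P\<close>. The explicit preimage under \<open>P\<close> allows an
  operator that vanishes on the range of \<open>P\<close> to be applied to the right-hand
  side.\<close>

lemma commuting_Qproj_maps_to_range:
  assumes "is_embedding_map P" and "A \<circ> Qproj P = Qproj P \<circ> A" and "A 0 = 0"
  shows "A (P \<xi>) = P (pseudo_inv P (A (P \<xi>)))"
proof -
  have "Qproj P (A (P \<xi>)) = A (Qproj P (P \<xi>))"
    using assms(2) by (metis comp_apply)
  also have "\<dots> = 0"
    by (simp add: Qproj_comp_self[OF assms(1)] assms(3))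
  finally show ?thesis
    by (simp add: Qproj_def)
qed

text \<open>This is \<open>B P = 0\<close> transposed. Tested against \<open>\<eta>\<close>, the
  left-hand side becomes \<open>pair \<psi> (B \<phi>)\<close> with \<open>\<phi>\<close>
  representing \<open>P (emb \<eta>)\<close>, and \<open>B \<phi> = 0\<close> because
  \<open>emb\<close> is injective.\<close>

lemma emb_transp_extd_eq_0:
  assumes "is_embedding_map P" and "transpose_pair A B"
    and "\<And>\<xi>. extd B (P \<xi>) = 0"
  shows "emb_transp P (extd A \<psi>) = 0"
proof (rule dual_eqI)
  fix \<eta>
  obtain \<phi> where \<phi>: "P (emb \<eta>) = emb \<phi>" "\<And>\<psi>. pair (emb_transp P \<psi>) \<eta> = pair \<psi> \<phi>"
    using is_emb_transpose_emb_transp[OF assms(1)] unfolding is_emb_transpose_def by blast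
  have "emb (B \<phi>) = 0"
    using assms(3)[of "emb \<eta>"] \<phi>(1) extd_emb_transpose[OF transpose_pair_sym[OF assms(2)]] by simp
  moreover have "emb (0 :: 'b) = 0"
    by (rule dual_eqI) (simp add: emb.rep_eq zero_dual.rep_eq bform_diff_left[of 0 0, simplified])
  ultimately have "B \<phi> = 0"
    using inj_emb by (metis injD)
  then show "pair (emb_transp P (extd A \<psi>)) \<eta> = pair 0 \<eta>"
    using pair_diff_right[of \<psi> 0 0]
    by (simp add: \<phi>(2) pair_extd_transpose[OF assms(2)] zero_dual.rep_eq)
qed

theorem theorem4p3:
  fixes L Lref Gref V W \<Omega> G T :: "'h::conj_form_space \<Rightarrow> 'h"
    and P :: "'e::conj_form_space dual \<Rightarrow> 'h dual"
    and PT :: "'h dual \<Rightarrow> 'e dual"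
    and Q :: "'h dual \<Rightarrow> 'h dual"
    and Leff :: "'e dual \<Rightarrow> 'e dual"
  assumes "symmetric_op L" and "pos_semidef (Im_op L)"
    and "is_embedding_map P"
    and PT: "PT = emb_transp P"
    and Q: "Q = Qproj P"
    and "symmetric_op Lref" and "extd Lref \<circ> Q = Q \<circ> extd Lref"
    and V: "V = Lref - L"
    and "Q_resolvent P Lref Gref"
    and W: "W = Gref \<circ> V"
    and "invertible_Lin (id - W)"
    and \<Omega>: "\<Omega> = inv (id - W)"
    and G: "G = \<Omega> \<circ> Gref"
    and T: "T = V + (V \<circ> G \<circ> V)"
    and Leff: "Leff = (PT \<circ> extd L \<circ> P) - (PT \<circ> extd L \<circ> extd G \<circ> extd L \<circ> P)"
  shows
    "L = Lref - V \<and>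
     Q_resolvent P L G \<and>
     extd \<Omega> = id + (extd G \<circ> extd V) \<and>
     extd Gref = extd (inv \<Omega>) \<circ> extd G \<and>
     extd \<Omega> \<circ> P = (id - (extd G \<circ> extd L)) \<circ> P \<and>
     extd (transpose_op \<Omega>) \<circ> P = P \<and>
     extd T = extd V \<circ> extd \<Omega> \<and>
     extd T = extd (transpose_op \<Omega>) \<circ> extd V \<and>
     PT \<circ> extd L \<circ> extd \<Omega> \<circ> P = Leff \<and>
     Leff = PT \<circ> (extd Lref - extd T) \<circ> P \<and>
     extd \<Omega> = id + (extd W \<circ> extd \<Omega>) \<and>
     extd \<Omega> = id + (extd \<Omega> \<circ> extd W) \<and>
     extd T = extd V + (extd T \<circ> extd W) \<and>
     extd T = extd V + (extd (transpose_op W) \<circ> extd T) \<and>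
     extd G = extd Gref + (extd W \<circ> extd G) \<and>
     extd G = extd Gref + (extd G \<circ> extd (transpose_op W))"
proof -

  \<comment> \<open>Operator identities on the space itself\<close>
  note emb = \<open>is_embedding_map P\<close>
  have Lref: "transpose_pair Lref Lref" and L: "transpose_pair L L"
    using \<open>symmetric_op Lref\<close> \<open>symmetric_op L\<close> by (simp_all add: symmetric_op_iff_transpose_pair)
  have Gref: "transpose_pair Gref Gref" and GrefP: "extd Gref \<circ> P = 0"
    and GrefLrefQ: "extd Gref \<circ> extd Lref \<circ> Q = Q"
    using \<open>Q_resolvent P Lref Gref\<close>
    by (simp_all add: Q_resolvent_def symmetric_op_iff_transpose_pair Q)
  have VV: "transpose_pair V V"
    unfolding V by (rule transpose_pair_diff[OF Lref L])
  have WW: "transpose_pair W (V \<circ> Gref)"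
    unfolding W by (rule transpose_pair_comp[OF Gref VV])
  have bij: "bij (id - W)" and \<Omega>Lin: "\<Omega> \<in> Lin"
    using \<open>invertible_Lin (id - W)\<close> by (simp_all add: invertible_Lin_def \<Omega>)
  have inv\<Omega>: "inv \<Omega> = id - W"
    unfolding \<Omega> by (rule inv_inv_eq[OF bij])
  \<comment> \<open>The right and left inverse laws, pointwise. Rearranged as \<open>r'\<close> and
    \<open>l'\<close> they are the two resolvent equations for \<open>\<Omega>\<close>, from which
    the identities for \<open>G\<close> and \<open>T\<close> follow by substitution.\<close>
  have r: "\<Omega> x - W (\<Omega> x) = x" for x
    using surj_f_inv_f[OF bij_is_surj[OF bij], of x] by (simp add: \<Omega>)
  have l: "\<Omega> (x - W x) = x" for x
    using inv_f_f[OF bij_is_inj[OF bij], of x] by (simp add: \<Omega>)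
  have Vadd: "V (x + y) = V x + V y" and Grefadd: "Gref (x + y) = Gref x + Gref y" for x y
    using VV Gref by (simp_all add: transpose_pair_def Lin_apply_add)
  have r': "x + W (\<Omega> x) = \<Omega> x" for x
    by (metis r diff_add_cancel)
  have l': "x + \<Omega> (W x) = \<Omega> x" for x
    by (metis l Lin_apply_diff[OF \<Omega>Lin] diff_add_cancel)
  have GV: "x + G (V x) = \<Omega> x" for x
    using l'[of x] by (simp add: G W)
  have \<Omega>W1: "\<Omega> = id + (W \<circ> \<Omega>)"
    by (rule ext) (simp add: r')
  have \<Omega>W2: "\<Omega> = id + (\<Omega> \<circ> W)"
    by (rule ext) (simp add: l')
  have \<Omega>GV: "\<Omega> = id + (G \<circ> V)"
    by (rule ext) (simp add: GV)
  have GLin: "G \<in> Lin"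
    unfolding G using \<Omega>Lin Gref by (simp add: Lin_comp transpose_pair_def)
  have GW: "Gref x + W (G x) = G x" for x
    using r'[of "Gref x"] by (simp add: G)
  \<comment> \<open>The expected transpose of \<open>\<Omega> = id + (G \<circ> V)\<close> is
    \<open>id + (V \<circ> G)\<close>, but symmetry of \<open>G\<close> is still open. Hence it is
    checked directly that this candidate is a right inverse of the transpose of
    \<open>id - W\<close>.\<close>
  have "(id - (V \<circ> Gref)) \<circ> (id + (V \<circ> G)) = id"
  proof
    fix x
    have "V (G x) = V (Gref x) + V (W (G x))"
      by (metis GW Vadd)
    then show "((id - (V \<circ> Gref)) \<circ> (id + (V \<circ> G))) x = id x"
      by (simp add: Vadd Grefadd W algebra_simps)
  qed
  moreover have "(id - W) \<circ> \<Omega> = id"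
    using r by (simp add: fun_eq_iff)
  moreover have "id + (V \<circ> G) \<in> Lin"
    using VV GLin by (simp add: Lin_add Lin_id Lin_comp transpose_pair_def)
  ultimately have \<Omega>\<Omega>: "transpose_pair \<Omega> (id + (V \<circ> G))"
    by (intro transpose_pair_inverse[OF transpose_pair_diff[OF transpose_pair_id WW] \<Omega>Lin])
  \<comment> \<open>The left-hand side is the transpose of \<open>\<Omega> \<circ> Gref\<close>, so
    this equation says that \<open>G\<close> is symmetric.\<close>
  have "Gref \<circ> (id + (V \<circ> G)) = G"
    using GW by (intro ext) (simp add: Grefadd W)
  then have GG: "transpose_pair G G"
    using transpose_pair_comp[OF \<Omega>\<Omega> Gref] by (simp add: G)
  have TV\<Omega>: "T = V \<circ> \<Omega>"
    by (rule ext) (simp add: T Vadd flip: GV)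
  have T\<Omega>V: "T = (id + (V \<circ> G)) \<circ> V"
    by (simp add: T fun_eq_iff)
  \<comment> \<open>The two factorizations of \<open>T\<close> are transposes of each other.\<close>
  have TT: "transpose_pair T T"
    using transpose_pair_comp[OF VV \<Omega>\<Omega>] by (simp flip: TV\<Omega> T\<Omega>V)
  have GWT: "G = Gref + (G \<circ> (V \<circ> Gref))"
    using GV by (intro ext) (simp add: G)
  have TTW: "T = V + (T \<circ> W)"
    by (rule ext) (simp add: TV\<Omega> l' flip: Vadd)
  have TWT: "T = V + ((V \<circ> Gref) \<circ> T)"
    using r' by (intro ext) (simp add: TV\<Omega> W flip: Vadd)

  \<comment> \<open>Transfer of the identities to the dual\<close>
  note tW = transpose_op_pair[OF WW] and t\<Omega> = transpose_op_pair[OF \<Omega>\<Omega>]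
  note WT = transpose_pair_comp[OF VV Gref]
  note comp = transpose_pair_comp
  have e\<Omega>: "extd \<Omega> = id + (extd G \<circ> extd V)"
    using extd_add[OF transpose_pair_id comp[OF GG VV]]
    by (simp add: extd_id extd_comp[OF GG VV] flip: \<Omega>GV)
  have e\<Omega>T: "extd (transpose_op \<Omega>) = id + (extd V \<circ> extd G)"
    unfolding t\<Omega> extd_add[OF transpose_pair_id comp[OF VV GG]] by (simp add: extd_id extd_comp[OF VV GG])
  have e\<Omega>1: "extd \<Omega> = id + (extd W \<circ> extd \<Omega>)"
    by (metis \<Omega>W1 extd_add extd_id extd_comp transpose_pair_id WW \<Omega>\<Omega> comp)
  have e\<Omega>2: "extd \<Omega> = id + (extd \<Omega> \<circ> extd W)"
    by (metis \<Omega>W2 extd_add extd_id extd_comp transpose_pair_id WW \<Omega>\<Omega> comp)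
  have eT1: "extd T = extd V \<circ> extd \<Omega>"
    unfolding TV\<Omega> by (rule extd_comp[OF VV \<Omega>\<Omega>])
  have eT2: "extd T = extd (transpose_op \<Omega>) \<circ> extd V"
    unfolding T\<Omega>V t\<Omega> by (rule extd_comp[OF transpose_pair_sym[OF \<Omega>\<Omega>] VV])
  have eT3: "extd T = extd V + (extd T \<circ> extd W)"
    by (metis TTW extd_add extd_comp VV TT WW comp)
  have eT4: "extd T = extd V + (extd (transpose_op W) \<circ> extd T)"
    unfolding tW by (metis TWT extd_add extd_comp VV TT WT comp)
  have "G = Gref + (W \<circ> G)"
    by (rule ext) (simp add: GW)
  then have eG1: "extd G = extd Gref + (extd W \<circ> extd G)"
    by (metis extd_add extd_comp GG Gref WW comp)
  have eG2: "extd G = extd Gref + (extd G \<circ> extd (transpose_op W))"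
    unfolding tW by (metis GWT extd_add extd_comp GG Gref WT comp)
  have eG: "extd G = extd \<Omega> \<circ> extd Gref"
    unfolding G by (rule extd_comp[OF \<Omega>\<Omega> Gref])
  have eW: "extd W = extd Gref \<circ> extd V"
    unfolding W by (rule extd_comp[OF Gref VV])
  have eV: "extd V = extd Lref - extd L"
    unfolding V by (rule extd_diff[OF Lref L])
  have eGref: "extd Gref = extd (inv \<Omega>) \<circ> extd G"
  proof -
    \<comment> \<open>With \<open>inv \<Omega> = id - W\<close> this is \<open>GW\<close>
      rearranged.\<close>
    have "inv \<Omega> \<circ> G = Gref"
      unfolding inv\<Omega> using GW
      by (intro ext) (metis add_diff_cancel_right' comp_apply fun_diff_def id_apply)
    then show ?thesis
      using extd_comp[OF transpose_pair_diff[OF transpose_pair_id WW] GG] by (simp add: inv\<Omega>)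
  qed

  \<comment> \<open>Relations involving the embedding map\<close>
  have extd0: "extd A 0 = 0" if "transpose_pair A B" for A B :: "'h \<Rightarrow> 'h"
    using extd_apply_diff[OF that, of 0 0] by simp
  have GP: "extd G (P \<xi>) = 0" for \<xi>
    using fun_cong[OF GrefP, of \<xi>] extd0[OF \<Omega>\<Omega>] by (simp add: eG)
  \<comment> \<open>On the range of \<open>Q\<close>, \<open>Gref\<close> applied to
    \<open>L = Lref - V\<close> gives \<open>1 - W\<close>, which \<open>\<Omega>\<close>
    cancels.\<close>
  have GLQ: "extd G (extd L (Q \<psi>)) = Q \<psi>" for \<psi>
  proof -
    have "extd L (Q \<psi>) = extd Lref (Q \<psi>) - extd V (Q \<psi>)"
      by (simp add: eV)
    then have "extd Gref (extd L (Q \<psi>)) = Q \<psi> - extd W (Q \<psi>)"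
      using fun_cong[OF GrefLrefQ, of \<psi>] by (simp add: extd_apply_diff[OF Gref] eW)
    then have "extd G (extd L (Q \<psi>)) = extd \<Omega> (Q \<psi>) - extd \<Omega> (extd W (Q \<psi>))"
      by (simp add: eG extd_apply_diff[OF \<Omega>\<Omega>])
    then show ?thesis
      by (metis e\<Omega>2 add_diff_cancel_right' comp_apply id_apply plus_fun_apply)
  qed
  have res: "Q_resolvent P L G"
    using GP GLQ \<open>symmetric_op L\<close> GG
    by (simp add: Q_resolvent_def symmetric_op_iff_transpose_pair fun_eq_iff flip: Q)
  have GLrefP: "extd G (extd Lref (P \<xi>)) = 0" for \<xi>
    using commuting_Qproj_maps_to_range[OF emb
        \<open>extd Lref \<circ> Q = Q \<circ> extd Lref\<close>[unfolded Q] extd0[OF Lref]] GP by metis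
  have \<Omega>P: "extd \<Omega> (P \<xi>) = P \<xi> - extd G (extd L (P \<xi>))" for \<xi>
    by (simp add: e\<Omega> eV extd_apply_diff[OF GG] GLrefP)
  \<comment> \<open>This is \<open>GLrefP\<close> transposed: \<open>G \<circ> Lref\<close> is the
    transpose of \<open>Lref \<circ> G\<close>.\<close>
  have PTLrefG: "PT (extd Lref (extd G \<psi>)) = 0" for \<psi>
    using emb_transp_extd_eq_0[OF emb comp[OF Lref GG]]
    by (simp add: PT extd_comp[OF GG Lref] extd_comp[OF Lref GG] GLrefP)
  note PTdiff = emb_transp_apply_diff[OF emb, folded PT]
  have Leff1: "PT \<circ> extd L \<circ> extd \<Omega> \<circ> P = Leff"
    by (simp add: Leff fun_eq_iff \<Omega>P extd_apply_diff[OF L] PTdiff)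
  have "PT (extd Lref (P \<xi>) - extd T (P \<xi>)) = PT (extd L (extd \<Omega> (P \<xi>)))" for \<xi>
  proof -
    \<comment> \<open>Since \<open>T = V \<Omega>\<close> and \<open>V = Lref - L\<close>, one has
      \<open>Lref - T = L \<Omega> - Lref (\<Omega> - 1)\<close>, and
      \<open>\<Omega> - 1 = G V\<close>. The last term is \<open>Lref G V\<close>, which the
      transpose of \<open>P\<close> annihilates.\<close>
    have "extd Lref (P \<xi>) - extd T (P \<xi>)
        = extd L (extd \<Omega> (P \<xi>)) - extd Lref (extd G (extd V (P \<xi>)))"
      using fun_cong[OF e\<Omega>, of "P \<xi>"] by (simp add: eT1 eV extd_apply_add[OF Lref])
    then show ?thesis
      by (simp add: PTdiff PTLrefG)
  qed
  then have Leff2: "Leff = PT \<circ> (extd Lref - extd T) \<circ> P"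
    by (simp add: fun_eq_iff flip: Leff1)
  have \<Omega>P': "extd \<Omega> \<circ> P = (id - (extd G \<circ> extd L)) \<circ> P"
    using \<Omega>P by (simp add: fun_eq_iff)
  have \<Omega>TP: "extd (transpose_op \<Omega>) \<circ> P = P"
    by (simp add: e\<Omega>T fun_eq_iff GP extd0[OF VV])
  have "L = Lref - V"
    by (simp add: V)
  then show ?thesis
    using res e\<Omega> eGref \<Omega>P' \<Omega>TP eT1 eT2 Leff1 Leff2 e\<Omega>1 e\<Omega>2 eT3 eT4 eG1 eG2 by blast
qed

end
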